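(* Let $n,\lambda_0,\lambda_1$ be non-negative integers with $\lambda_0+\lambda_1=n$ and $\{\lambda_0,\lambda_1\}\cap\{0,n\}=\emptyset$. Then there does not exist a nonempty set $\{F_1,\dots,F_k\}$ of mutually orthogonal binary frequency squares of type $(n;\lambda_0,\lambda_1)$ whose sum $F_1+\cdots+F_k$ (ordinary matrix addition over $\mathbb{Z}$) is a constant matrix.
   Context: A binary frequency square of type $(n;\lambda_0,\lambda_1)$ is an $n\times n$ $(0,1)$-matrix with exactly $\lambda_0$ zeros and $\lambda_1$ ones in each row and column; two such squares are orthogonal if exactly $\lambda_1^2$ cells contain $1$ in both; mutually orthogonal means pairwise orthogonal. *)

theory Defs
  imports "Jordan_Normal_Form.Matrix"
begin

definition binary_freq_square :: "nat \<Rightarrow> nat \<Rightarrow> nat \<Rightarrow> int mat \<Rightarrow> bool" where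
  "binary_freq_square n l0 l1 F \<longleftrightarrow>
     F \<in> carrier_mat n n \<and>
     (\<forall>i<n. \<forall>j<n. F $$ (i, j) \<in> {0, 1}) \<and>
     (\<forall>i<n. card {j. j < n \<and> F $$ (i, j) = 0} = l0 \<and> card {j. j < n \<and> F $$ (i, j) = 1} = l1) \<and>
     (\<forall>j<n. card {i. i < n \<and> F $$ (i, j) = 0} = l0 \<and> card {i. i < n \<and> F $$ (i, j) = 1} = l1)"

definition orthogonal_squares :: "nat \<Rightarrow> nat \<Rightarrow> int mat \<Rightarrow> int mat \<Rightarrow> bool" where
  "orthogonal_squares n l1 F G \<longleftrightarrow>
     card {(i, j). i < n \<and> j < n \<and> F $$ (i, j) = 1 \<and> G $$ (i, j) = 1} = l1\<^sup>2"

definition mutually_orthogonal_bfs :: "nat \<Rightarrow> nat \<Rightarrow> nat \<Rightarrow> int mat set \<Rightarrow> bool" where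
  "mutually_orthogonal_bfs n l0 l1 S \<longleftrightarrow>
     (\<forall>F\<in>S. binary_freq_square n l0 l1 F) \<and> pairwise (orthogonal_squares n l1) S"

text \<open>The type \<^typ>\<open>'a mat\<close> is not an instance of \<^class>\<open>comm_monoid_add\<close>, so the sum of a
  finite set of square matrices is written out entrywise; the two lemmas below confirm that it
  is the iterated matrix addition.\<close>

definition sum_of_mats :: "nat \<Rightarrow> int mat set \<Rightarrow> int mat" where
  "sum_of_mats n S = mat n n (\<lambda>(i, j). \<Sum>F\<in>S. F $$ (i, j))"

lemma sum_of_mats_empty: "sum_of_mats n {} = 0\<^sub>m n n"
  by (rule eq_matI) (auto simp: sum_of_mats_def)

lemma sum_of_mats_insert:
  assumes "finite S" "F \<notin> S" "F \<in> carrier_mat n n"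
  shows "sum_of_mats n (insert F S) = F + sum_of_mats n S"
  using assms by (intro eq_matI) (auto simp: sum_of_mats_def)

definition constant_mat :: "'a mat \<Rightarrow> bool" where
  "constant_mat A \<longleftrightarrow> (\<exists>c. \<forall>i < dim_row A. \<forall>j < dim_col A. A $$ (i, j) = c)"

end

theory Submission
  imports Defs
begin

text \<open>Pair a square \<open>F\<close> of the set with the constant sum \<open>c J\<close>, where \<open>J\<close> is the all-ones matrix.
  Orthogonality gives \<open>c n \<lambda>\<^sub>1 = n \<lambda>\<^sub>1 + (k - 1) \<lambda>\<^sub>1\<^sup>2\<close>, while a row sum of \<open>c J\<close> gives
  \<open>k \<lambda>\<^sub>1 = n c\<close>; together these force \<open>\<lambda>\<^sub>1 = n\<close>.\<close>

lemma bfs_row_sum: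
  assumes "binary_freq_square n l0 l1 F" "i < n"
  shows "(\<Sum>j<n. F $$ (i, j)) = int l1"
proof -
  have "(\<Sum>j<n. F $$ (i, j)) = (\<Sum>j<n. if F $$ (i, j) = 1 then 1 else 0)"
    using assms by (intro sum.cong) (auto simp: binary_freq_square_def)
  also have "\<dots> = int (card {j. j < n \<and> F $$ (i, j) = 1})"
    by (simp add: sum.If_cases Int_def)
  finally show ?thesis
    using assms by (simp add: binary_freq_square_def)
qed

lemma bfs_total_sum:
  assumes "binary_freq_square n l0 l1 F"
  shows "(\<Sum>i<n. \<Sum>j<n. F $$ (i, j)) = int n * int l1"
  using bfs_row_sum[OF assms] by simp

text \<open>A 0/1 entry is its own square. This supplies the diagonal term, which orthogonality of
  distinct squares does not cover.\<close>

lemma bfs_inner_self: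
  assumes "binary_freq_square n l0 l1 F"
  shows "(\<Sum>i<n. \<Sum>j<n. F $$ (i, j) * F $$ (i, j)) = int n * int l1"
proof -
  have "(\<Sum>i<n. \<Sum>j<n. F $$ (i, j) * F $$ (i, j)) = (\<Sum>i<n. \<Sum>j<n. F $$ (i, j))"
    using assms by (intro sum.cong refl) (auto simp: binary_freq_square_def)
  then show ?thesis
    by (simp add: bfs_total_sum[OF assms])
qed

text \<open>A product of 0/1 entries is the indicator that both are 1, so the entrywise inner
  product counts the cells in \<open>orthogonal_squares\<close>.\<close>

lemma bfs_inner_orthogonal:
  assumes "binary_freq_square n l0 l1 F" "binary_freq_square n l0 l1 G"
    and "orthogonal_squares n l1 F G"
  shows "(\<Sum>i<n. \<Sum>j<n. F $$ (i, j) * G $$ (i, j)) = (int l1)\<^sup>2"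
proof -
  let ?both = "\<lambda>p. F $$ p = 1 \<and> G $$ p = 1"
  have "(\<Sum>i<n. \<Sum>j<n. F $$ (i, j) * G $$ (i, j)) = (\<Sum>p\<in>{..<n} \<times> {..<n}. F $$ p * G $$ p)"
    by (simp add: sum.cartesian_product case_prod_unfold)
  also have "\<dots> = (\<Sum>p\<in>{..<n} \<times> {..<n}. if ?both p then 1 else 0)"
    using assms(1,2) by (intro sum.cong) (auto simp: binary_freq_square_def)
  also have "\<dots> = int (card ({..<n} \<times> {..<n} \<inter> {p. ?both p}))"
    by (simp add: sum.If_cases)
  also have "{..<n} \<times> {..<n} \<inter> {p. ?both p} =
      {(i, j). i < n \<and> j < n \<and> F $$ (i, j) = 1 \<and> G $$ (i, j) = 1}"
    by auto
  finally show ?thesis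
    using assms(3) by (simp add: orthogonal_squares_def)
qed

theorem theorem3p5:
  fixes n l0 l1 :: nat
  assumes "l0 + l1 = n"
    and "{l0, l1} \<inter> {0, n} = {}"
  shows "\<not> (\<exists>S :: int mat set. finite S \<and> S \<noteq> {} \<and>
              mutually_orthogonal_bfs n l0 l1 S \<and> constant_mat (sum_of_mats n S))"
proof
  assume "\<exists>S :: int mat set. finite S \<and> S \<noteq> {} \<and>
            mutually_orthogonal_bfs n l0 l1 S \<and> constant_mat (sum_of_mats n S)"
  then obtain S :: "int mat set" and F where fin: "finite S" and F: "F \<in> S"
    and mo: "mutually_orthogonal_bfs n l0 l1 S" and const: "constant_mat (sum_of_mats n S)"
    by blast
  have l1: "l1 \<noteq> 0" "l1 \<noteq> n" and n: "0 < n"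
    using assms by auto
  have bfs: "binary_freq_square n l0 l1 G" if "G \<in> S" for G
    using mo that by (simp add: mutually_orthogonal_bfs_def)
  from const obtain c where c: "\<And>i j. i < n \<Longrightarrow> j < n \<Longrightarrow> (\<Sum>G\<in>S. G $$ (i, j)) = c"
    by (auto simp: constant_mat_def sum_of_mats_def)
  \<comment> \<open>Count row 0 of the sum in two ways; this row exists because \<open>n\<close> is
    positive.\<close>
  have "int (card S) * int l1 = (\<Sum>G\<in>S. \<Sum>j<n. G $$ (0, j))"
    using bfs_row_sum[OF bfs n] by simp
  also have "\<dots> = (\<Sum>j<n. \<Sum>G\<in>S. G $$ (0, j))"
    by (rule sum.swap)
  also have "\<dots> = int n * c"
    using c n by simp
  finally have row: "int (card S) * int l1 = int n * c" .
  have "int n * int l1 * c = (\<Sum>i<n. \<Sum>j<n. F $$ (i, j) * c)"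
    by (simp add: bfs_total_sum[OF bfs[OF F]] flip: sum_distrib_right)
  also have "\<dots> = (\<Sum>i<n. \<Sum>j<n. \<Sum>G\<in>S. F $$ (i, j) * G $$ (i, j))"
    using c by (intro sum.cong refl) (simp flip: sum_distrib_left)
  \<comment> \<open>Fixing one index set as \<open>S\<close> directs the interchange, so rewriting
    cannot swap the sums back and forth.\<close>
  also have "\<dots> = (\<Sum>G\<in>S. \<Sum>i<n. \<Sum>j<n. F $$ (i, j) * G $$ (i, j))"
    by (simp add: sum.swap[of _ S])
  also have "\<dots> = (\<Sum>i<n. \<Sum>j<n. F $$ (i, j) * F $$ (i, j)) +
      (\<Sum>G\<in>S - {F}. \<Sum>i<n. \<Sum>j<n. F $$ (i, j) * G $$ (i, j))"
    by (rule sum.remove[OF fin F])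
  also have "\<dots> = int n * int l1 + (\<Sum>G\<in>S - {F}. (int l1)\<^sup>2)"
    using mo F bfs
    by (intro arg_cong2[where f = "(+)"] sum.cong refl bfs_inner_self bfs_inner_orthogonal)
      (auto simp: mutually_orthogonal_bfs_def pairwise_def)
  \<comment> \<open>Since \<open>F\<close> lies in \<open>S\<close>, \<open>card S\<close> is at
    least 1 and the subtraction agrees over the naturals and the integers.\<close>
  also have "\<dots> = int n * int l1 + (int (card S) - 1) * (int l1)\<^sup>2"
    using fin F card_gt_0_iff[of S] by (auto simp: of_nat_diff Suc_le_eq)
  finally have "int l1 * (c * int n) = int l1 * (int n + (int (card S) - 1) * int l1)"
    by (simp add: algebra_simps power2_eq_square)
  then have "c * int n = int n + (int (card S) - 1) * int l1"
    using l1 by simp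
  \<comment> \<open>Replacing \<open>c * int n\<close> by \<open>int (card S) * int l1\<close>
    cancels all multiples of \<open>l1\<close> but one and leaves \<open>l1 = n\<close>.\<close>
  then show False
    using row l1 by (simp add: algebra_simps)
qed

end
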